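(* Let $(a_n)_{n\ge1}$ be a strictly increasing sequence of positive integers which is quasi-arithmetic of degree $1$. Then there is no $\alpha\in\mathbb{R}$ such that the sequence $(\{a_n\alpha\})_{n\ge1}$ has Poissonian pair correlations.
   Context: $\{x\}$ denotes the fractional part of $x$ and $\|x\|$ the distance from $x$ to the nearest integer. A sequence $(x_n)_{n\ge1}$ in $[0,1)$ has (asymptotically) Poissonian pair correlations if for every $s>0$, $$R_2([-s,s],(x_n)_n,N):=\frac1N\#\left\{1\le i\ne j\le N : \|x_i-x_j\|\le \frac sN\right\}\longrightarrow 2s \quad (N\to\infty).$$ A $d$-dimensional arithmetic progression is a set of the form $\{h+\sum_{j=1}^d r_jk_j : 0\le r_j<s_j \text{ for } j=1,\dots,d\}$ with $h,k_1,\dots,k_d,s_1,\dots,s_d\in\mathbb{Z}$; its size is $s_1s_2\cdots s_d$. A strictly increasing sequence $(a_n)_{n\ge1}$ of positive integers is called quasi-arithmetic of degree $d$ (with $d$ a positive integer) if there exist constants $C,K>0$ and a strictly increasing sequence $(N_i)_{i\ge1}$ of positive integers such that for every $i\ge1$ there is a subset $A^{(i)}\subset\{a_n:1\le n\le N_i\}$ with $|A^{(i)}|\ge CN_i$ which is contained in a $d$-dimensional arithmetic progression $P^{(i)}$ of size at most $KN_i$. *)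

theory Defs
  imports Complex_Main
begin

text \<open>Sequences are indexed by \<open>n \<ge> 1\<close>; the value at \<open>0\<close> is never used.\<close>

definition dist_nearest_int :: "real \<Rightarrow> real" where
  "dist_nearest_int x = \<bar>x - of_int (round x)\<bar>"

text \<open>\<open>pair_correlation s x N\<close> is $R_2([-s,s],(x_n)_n,N)$; it counts ordered pairs.\<close>

definition pair_correlation :: "real \<Rightarrow> (nat \<Rightarrow> real) \<Rightarrow> nat \<Rightarrow> real" where
  "pair_correlation s x N =
     (1 / real N) *
     real (card {(i, j). i \<in> {1..N} \<and> j \<in> {1..N} \<and> i \<noteq> j \<and>
                         dist_nearest_int (x i - x j) \<le> s / real N})"

definition poissonian_pair_correlations :: "(nat \<Rightarrow> real) \<Rightarrow> bool" where
  "poissonian_pair_correlations x \<longleftrightarrow>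
     (\<forall>s>0. (\<lambda>N. pair_correlation s x N) \<longlonglongrightarrow> 2 * s)"

definition arith_progression :: "nat \<Rightarrow> int \<Rightarrow> (nat \<Rightarrow> int) \<Rightarrow> (nat \<Rightarrow> int) \<Rightarrow> int set" where
  "arith_progression d h k s =
     {h + (\<Sum>j=1..d. r j * k j) | r. \<forall>j\<in>{1..d}. 0 \<le> r j \<and> r j < s j}"

text \<open>The size belongs to the presentation of a progression, not to the underlying set:
  it exceeds the cardinality when representations are not unique.\<close>

definition arith_progression_size :: "nat \<Rightarrow> (nat \<Rightarrow> int) \<Rightarrow> int" where
  "arith_progression_size d s = (\<Prod>j=1..d. s j)"

text \<open>The side lengths \<open>s j\<close> need no positivity condition below: as \<open>A\<close> is nonempty,
  so is the progression containing it, which forces \<open>s j > 0\<close> for all \<open>j\<close>.\<close>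

definition quasi_arithmetic :: "nat \<Rightarrow> (nat \<Rightarrow> int) \<Rightarrow> bool" where
  "quasi_arithmetic d a \<longleftrightarrow> d \<ge> 1 \<and>
     (\<exists>(C::real) (K::real) (N :: nat \<Rightarrow> nat).
        C > 0 \<and> K > 0 \<and> strict_mono_on {1..} N \<and> (\<forall>i\<ge>1. N i > 0) \<and>
        (\<forall>i\<ge>1. \<exists>A \<subseteq> a ` {1..N i}.
           real (card A) \<ge> C * real (N i) \<and>
           (\<exists>h k s. A \<subseteq> arith_progression d h k s \<and>
                    real_of_int (arith_progression_size d s) \<le> K * real (N i))))"

end

theory Submission
  imports Defs "HOL-Analysis.Kronecker_Approximation_Theorem"
begin

text \<open>
  Poissonian pair correlations forbid atoms: since the limit \<open>2s\<close> is continuous in \<open>s\<close>, no positive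
  proportion of the pairs can sit at exactly one distance of order \<open>1/N\<close>.  A quasi-arithmetic
  sequence of degree 1 produces such an atom.  Let the progression have step \<open>k\<close> and let \<open>q\<close> be a
  Dirichlet denominator of \<open>k\<alpha>\<close>, at most a small multiple of \<open>N\<close>.  If \<open>J\<close> is a
  large constant, most elements of \<open>A\<close> have another element of \<open>A\<close> exactly \<open>j q\<close> steps further
  along for some \<open>j \<le> J\<close>, so some fixed \<open>j\<close> occurs for a positive proportion of them.  All
  these pairs give the same distance \<open>\<parallel>j q k \<alpha>\<parallel>\<close>, which is of order \<open>1/N\<close>.
\<close>

section \<open>Distance to the nearest integer\<close>

lemma dist_nearest_int_le: "dist_nearest_int x \<le> \<bar>x - of_int m\<bar>"
  unfolding dist_nearest_int_def by (rule round_diff_minimal)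

lemma dist_nearest_int_nonneg: "0 \<le> dist_nearest_int x"
  by (simp add: dist_nearest_int_def)

lemma dist_nearest_int_add_int: "dist_nearest_int (x + of_int m) = dist_nearest_int x"
proof -
  \<comment> \<open>One inequality for all shifts is enough: shifting back by \<open>- m\<close>
    gives the reverse one.\<close>
  have "dist_nearest_int (y + of_int n) \<le> dist_nearest_int y" for y :: real and n
    using dist_nearest_int_le[of "y + of_int n" "round y + n"]
    by (simp add: dist_nearest_int_def)
  from this[of x m] this[of "x + of_int m" "- m"] show ?thesis
    by simp
qed

text \<open>Taking fractional parts changes the difference by an integer only, so pair distances
  depend on the differences of the \<open>a n\<close> alone.\<close>

lemma dist_nearest_int_frac_diff: "dist_nearest_int (frac x - frac y) = dist_nearest_int (x - y)"
  using dist_nearest_int_add_int[of "x - y" "\<lfloor>y\<rfloor> - \<lfloor>x\<rfloor>"]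
  by (simp add: frac_def algebra_simps)

section \<open>Recurring differences in dense sets of integers\<close>

text \<open>A packing argument bounds the set \<open>B\<close> of elements with no partner
  \<open>j * q\<close> further along, \<open>j\<close> in \<open>{1..J}\<close>: its translates by
  \<open>0, q, ..., (J - 1) * q\<close> are disjoint and lie in an interval of length
  \<open>s + J * q\<close>. The rest of \<open>R\<close> is covered by \<open>J\<close> sets, one
  for each \<open>j\<close>, and one of them is at least average.\<close>

lemma exists_frequent_difference:
  fixes R :: "int set" and q s :: int and J :: nat
  assumes R: "R \<subseteq> {0..<s}" "R \<noteq> {}" and q: "q > 0" and J: "J > 0"
  obtains j where "j \<in> {1..J}"
    and "real (card R) - (real_of_int s / real J + real_of_int q)
           \<le> real J * real (card {r \<in> R. r + int j * q \<in> R})"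
proof -
  define S where "S j = {r \<in> R. r + int j * q \<in> R}" for j
  define B where "B = {r \<in> R. \<forall>j\<in>{1..J}. r + int j * q \<notin> R}"
  have fin: "finite R" using R finite_subset by blast
  have finB: "finite B" and finS: "finite (S j)" for j using fin by (auto simp: B_def S_def)
  have s: "s > 0" using R by fastforce
  \<comment> \<open>If two translates met, two elements of \<open>B\<close> would differ by a
    forbidden multiple of \<open>q\<close>.\<close>
  have "inj_on (\<lambda>(r, j). r + int j * q) (B \<times> {0..<J})"
  proof -
    have no: False if "r \<in> B" "r' \<in> B" "i < j" "j < J" "r + int j * q = r' + int i * q" for r r' i j
    proof -
      have "r' = r + int (j - i) * q" using that by (simp add: of_nat_diff algebra_simps)
      moreover have "j - i \<in> {1..J}" using that by auto
      ultimately show False using that(1,2) by (auto simp: B_def)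
    qed
    show ?thesis
    proof (rule inj_onI, clarsimp)
      fix r i r' i'
      assume *: "r \<in> B" "i < J" "r' \<in> B" "i' < J" "r + int i * q = r' + int i' * q"
      have "i = i'" using no[of r r' i' i] no[of r' r i i'] * by (metis linorder_neqE_nat)
      with * show "r = r' \<and> i = i'" by simp
    qed
  qed
  moreover have "(\<lambda>(r, j). r + int j * q) ` (B \<times> {0..<J}) \<subseteq> {0..<s + int J * q}"
  proof clarsimp
    fix r i assume *: "r \<in> B" "i < J"
    then have "0 \<le> r" "r < s" using R by (auto simp: B_def)
    moreover have "0 \<le> int i * q" "int i * q \<le> int J * q"
      using * q by (auto intro: mult_right_mono)
    ultimately show "0 \<le> r + int i * q \<and> r + int i * q < s + int J * q" by linarith
  qed
  ultimately have "card (B \<times> {0..<J}) \<le> card {0..<s + int J * q}"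
    using card_inj_on_le by blast
  then have "int (card B * J) \<le> s + int J * q"
    using s q by (simp add: card_cartesian_product le_nat_iff)
  then have "real_of_int (int (card B * J)) \<le> real_of_int (s + int J * q)"
    by (simp only: of_int_le_iff)
  then have B: "real (card B) \<le> real_of_int s / real J + real_of_int q"
    using J by (simp add: field_simps)
  have "R \<subseteq> B \<union> (\<Union>j\<in>{1..J}. S j)" by (auto simp: B_def S_def)
  then have "card R \<le> card (B \<union> (\<Union>j\<in>{1..J}. S j))"
    using finB finS by (intro card_mono) auto
  also have "\<dots> \<le> card B + card (\<Union>j\<in>{1..J}. S j)" by (rule card_Un_le)
  also have "\<dots> \<le> card B + (\<Sum>j\<in>{1..J}. card (S j))"
    by (intro add_left_mono card_UN_le) auto
  finally have "real (card R) \<le> real (card B) + (\<Sum>j\<in>{1..J}. real (card (S j)))"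
    by (metis of_nat_add of_nat_le_iff of_nat_sum)
  with B have sum: "real (card R) - (real_of_int s / real J + real_of_int q)
      \<le> (\<Sum>j\<in>{1..J}. real (card (S j)))" (is "?X \<le> _") by linarith
  have "\<exists>j\<in>{1..J}. ?X / real J \<le> real (card (S j))"
  proof (rule ccontr)
    assume "\<not> ?thesis"
    then have "(\<Sum>j\<in>{1..J}. real (card (S j))) < (\<Sum>j\<in>{1..J}. ?X / real J)"
      using J by (intro sum_strict_mono) (auto simp: not_le)
    with sum J show False by simp
  qed
  then obtain j where "j \<in> {1..J}" "?X / real J \<le> real (card (S j))" by blast
  with that[of j] J show ?thesis by (simp add: S_def field_simps)
qed

section \<open>Absence of atoms\<close>

text \<open>Pairs at distance exactly \<tau>\<open>/N\<close> are counted between two neighbouring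
  points of a grid of mesh \<eta>, where the limit grows by only \<open>2\<close> \<eta>.
  Convergence at finitely many grid points handles all \<tau> in \<open>{0..T}\<close> at once; this
  uniformity matters because \<tau> will vary with \<open>N\<close>.\<close>

lemma poissonian_pair_correlations_no_atoms:
  assumes x: "poissonian_pair_correlations x" and c: "c > 0"
  shows "\<forall>\<^sub>F N in sequentially. \<forall>\<tau>\<in>{0..T}.
    real (card {(i, j). i \<in> {1..N} \<and> j \<in> {1..N} \<and> i \<noteq> j \<and>
                        dist_nearest_int (x i - x j) = \<tau> / real N}) < c * real N"
proof -
  \<comment> \<open>A grid cell contributes \<open>2\<close> \<eta>, and the errors at its two ends
    at most \<eta> each: \<open>4\<close> \<eta> in total, which is \<open>c / 2\<close>.\<close>
  define \<eta> where "\<eta> = c / 8"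
  define M where "M = nat \<lceil>T / \<eta>\<rceil> + 1"
  define P where "P N t = {(i, j). i \<in> {1..N} \<and> j \<in> {1..N} \<and> i \<noteq> j \<and>
                        dist_nearest_int (x i - x j) \<le> t / real N}" for N :: nat and t
  define E where "E N t = {(i, j). i \<in> {1..N} \<and> j \<in> {1..N} \<and> i \<noteq> j \<and>
                        dist_nearest_int (x i - x j) = t / real N}" for N :: nat and t
  have \<eta>: "\<eta> > 0" using c by (simp add: \<eta>_def)
  have finP: "finite (P N t)" for N t
    by (rule finite_subset[of _ "{1..N} \<times> {1..N}"]) (auto simp: P_def)
  have finE: "finite (E N t)" for N t
    by (rule finite_subset[of _ "{1..N} \<times> {1..N}"]) (auto simp: E_def)
  have "\<forall>\<^sub>F N in sequentially. \<forall>m\<in>{1..M}.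
          \<bar>pair_correlation (real m * \<eta>) x N - 2 * (real m * \<eta>)\<bar> < \<eta>"
  proof (rule eventually_ball_finite)
    show "\<forall>m\<in>{1..M}. \<forall>\<^sub>F N in sequentially.
            \<bar>pair_correlation (real m * \<eta>) x N - 2 * (real m * \<eta>)\<bar> < \<eta>"
    proof
      fix m assume "m \<in> {1..M}"
      then have "(\<lambda>N. pair_correlation (real m * \<eta>) x N) \<longlonglongrightarrow> 2 * (real m * \<eta>)"
        using x \<eta> by (simp add: poissonian_pair_correlations_def)
      from tendstoD[OF this \<eta>]
      show "\<forall>\<^sub>F N in sequentially.
              \<bar>pair_correlation (real m * \<eta>) x N - 2 * (real m * \<eta>)\<bar> < \<eta>"
        by (simp add: dist_real_def)
    qed
  qed simp
  then have "\<forall>\<^sub>F N in sequentially. \<forall>\<tau>\<in>{0..T}. real (card (E N \<tau>)) < c * real N"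
    using eventually_gt_at_top[of 0]
  proof eventually_elim
    case (elim N)
    have R: "real (card (P N (real m * \<eta>))) < (2 * real m + 1) * \<eta> * N \<and>
             real (card (P N (real m * \<eta>))) > (2 * real m - 1) * \<eta> * N" if "m \<in> {1..M}" for m :: nat
    proof -
      have "\<bar>real (card (P N (real m * \<eta>))) / N - 2 * (real m * \<eta>)\<bar> < \<eta>"
        using elim(1) that by (simp add: pair_correlation_def P_def)
      then show ?thesis using elim(2) by (auto simp: abs_less_iff field_simps)
    qed
    show ?case
    proof
      fix \<tau> assume \<tau>: "\<tau> \<in> {0..T}"
      define m where "m = nat \<lceil>\<tau> / \<eta>\<rceil>"
      have m: "\<tau> \<le> real m * \<eta>"
      proof -
        have "\<tau> / \<eta> \<le> real m" unfolding m_def by linarith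
        then show ?thesis using \<eta> by (simp add: field_simps)
      qed
      have "m < M" unfolding m_def M_def
        using \<tau> \<eta> by (intro less_Suc_eq_le[THEN iffD2, unfolded Suc_eq_plus1] nat_mono ceiling_mono divide_right_mono) auto
      show "real (card (E N \<tau>)) < c * real N"
      proof (cases "m \<ge> 2")
        \<comment> \<open>The grid starts at \<open>m = 1\<close>, since convergence is known for
          positive \<open>s\<close> only. The first cell is therefore bounded by the whole count up
          to \<eta>.\<close>
        case False
        then have "\<tau> \<le> real 1 * \<eta>"
          using m \<eta> by (smt (verit, best) One_nat_def less_2_cases linorder_not_less mult_right_mono of_nat_0 of_nat_1)
        then have "E N \<tau> \<subseteq> P N (real 1 * \<eta>)"
          using elim(2) by (auto simp: E_def P_def divide_right_mono)
        then have "real (card (E N \<tau>)) \<le> real (card (P N (real 1 * \<eta>)))"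
          using finP card_mono by (metis of_nat_le_iff)
        also have "\<dots> < 3 * \<eta> * N" using R[of 1] \<open>m < M\<close> by simp
        also have "\<dots> \<le> c * N" using c by (simp add: \<eta>_def)
        finally show ?thesis .
      next
        case True
        \<comment> \<open>By minimality of the ceiling, \<tau> lies strictly above the previous grid
          point, so the count there misses every pair of the atom.\<close>
        have lower: "real (m - 1) * \<eta> < \<tau>"
        proof -
          have "real (m - 1) < \<tau> / \<eta>" using True unfolding m_def by linarith
          then show ?thesis using \<eta> by (simp add: field_simps)
        qed
        have "E N \<tau> \<inter> P N (real (m - 1) * \<eta>) = {}"
          using lower elim(2) by (auto simp: E_def P_def divide_le_cancel)
        moreover have "E N \<tau> \<union> P N (real (m - 1) * \<eta>) \<subseteq> P N (real m * \<eta>)"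
        proof -
          have "real (m - 1) * \<eta> / N \<le> real m * \<eta> / N"
            using \<eta> by (intro divide_right_mono mult_right_mono) auto
          then show ?thesis using m elim(2) by (auto simp: E_def P_def divide_right_mono)
        qed
        ultimately have "card (E N \<tau>) + card (P N (real (m - 1) * \<eta>)) \<le> card (P N (real m * \<eta>))"
          using finE finP by (metis card_Un_disjoint card_mono)
        moreover have "real (card (P N (real m * \<eta>))) < (2 * real m + 1) * \<eta> * N"
          using R[of m] True \<open>m < M\<close> by simp
        moreover have "real (card (P N (real (m - 1) * \<eta>))) > (2 * real m - 3) * \<eta> * N"
        proof -
          have "m - 1 \<in> {1..M}" "real (m - 1) = real m - 1" using True \<open>m < M\<close> by auto
          then show ?thesis using R[of "m - 1"] by simp
        qed
        ultimately have "real (card (E N \<tau>)) < (2 * real m + 1) * \<eta> * N - (2 * real m - 3) * \<eta> * N"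
          by simp
        also have "\<dots> = 4 * \<eta> * N" by (simp add: algebra_simps)
        also have "\<dots> \<le> c * N" using c by (simp add: \<eta>_def)
        finally show ?thesis .
      qed
    qed
  qed
  then show ?thesis by (simp add: E_def)
qed

section \<open>Atoms from arithmetic progressions\<close>

text \<open>All pairs of terms \<open>j * q\<close> steps apart share one distance, small because
  \<open>q\<close> is a Dirichlet denominator of \<open>k\<close> \<alpha>. The range of \<tau> and
  the proportion of pairs depend on \<open>C\<close> and \<open>J\<close> only, not on
  \<open>N\<close>.\<close>

lemma arith_progression_atom:
  fixes a :: "nat \<Rightarrow> int" and h k s :: int
  assumes inj: "inj_on a {1..N}"
    and A: "A \<subseteq> a ` {1..N}" "A \<subseteq> (\<lambda>r. h + r * k) ` {0..<s}"
    and C: "C > 0" "real (card A) \<ge> C * real N" and s: "real_of_int s \<le> K * real N"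
    and J: "J > 0" "4 * K \<le> C * real J" and N: "C * real N > 4"
  obtains \<tau> where "\<tau> \<in> {0..4 * real J / C}"
    and "C / (4 * real J) * real N \<le> real (card {(i, j). i \<in> {1..N} \<and> j \<in> {1..N} \<and> i \<noteq> j \<and>
           dist_nearest_int (frac (of_int (a i) * \<alpha>) - frac (of_int (a j) * \<alpha>)) = \<tau> / real N})"
proof -
  define R where "R = {r \<in> {0..<s}. h + r * k \<in> A}"
  have Npos: "real N > 0" using N C by (cases "N = 0") auto
  have finA: "finite A" using A(1) finite_subset by blast
  have k: "k \<noteq> 0"
  proof
    assume "k = 0"
    then have "A \<subseteq> {h}" using A(2) by auto
    then have "card A \<le> 1" using card_mono[of "{h}" A] by simp
    with C N show False by linarith
  qed
  have "A \<subseteq> (\<lambda>r. h + r * k) ` R" using A(2) by (force simp: R_def)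
  moreover have finR: "finite R" by (rule finite_subset[of _ "{0..<s}"]) (auto simp: R_def)
  ultimately have "card A \<le> card R" by (meson surj_card_le)
  then have cardR: "C * real N \<le> real (card R)" using C by linarith
  have R: "R \<subseteq> {0..<s}" by (auto simp: R_def)
  have "R \<noteq> {}" using cardR N by auto
  \<comment> \<open>\<open>Q\<close> balances two needs. The loss \<open>s / J + q\<close> is at
    most \<open>C * N / 2 + 1\<close>, which leaves at least \<open>C * N / 4\<close> as
    \<open>C * N > 4\<close>; and the approximation error \<open>1 / Q\<close> is at most
    \<open>4 / (C * N)\<close>.\<close>
  define Q where "Q = nat \<lceil>C * N / 4\<rceil>"
  have Q: "C * N / 4 \<le> real Q" "real Q < C * N / 4 + 1" "Q > 0"
    using N unfolding Q_def by linarith+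
  obtain p q where q: "0 < q" "q \<le> int Q" "\<bar>of_int q * (of_int k * \<alpha>) - of_int p\<bar> < 1 / Q"
    using Dirichlet_approx[OF \<open>Q > 0\<close>, of "of_int k * \<alpha>"] by metis
  obtain j where j: "j \<in> {1..J}" and many:
    "real (card R) - (real_of_int s / real J + real_of_int q)
       \<le> real J * real (card {r \<in> R. r + int j * q \<in> R})"
    using exists_frequent_difference[of R s q J] q(1) J(1) R \<open>R \<noteq> {}\<close> by blast
  define S where "S = {r \<in> R. r + int j * q \<in> R}"
  define D where "D = dist_nearest_int (of_int (int j * q * k) * \<alpha>)"
  define E where "E = {(i, j). i \<in> {1..N} \<and> j \<in> {1..N} \<and> i \<noteq> j \<and>
           dist_nearest_int (frac (of_int (a i) * \<alpha>) - frac (of_int (a j) * \<alpha>)) = D}"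
  have "real_of_int s / real J \<le> C * N / 4"
  proof -
    have "4 * real_of_int s \<le> 4 * K * N" using s by simp
    also have "\<dots> \<le> C * J * N" using J Npos by (intro mult_right_mono) auto
    finally show ?thesis using J by (simp add: field_simps)
  qed
  moreover have "real_of_int q \<le> real Q" using q(2) by linarith
  ultimately have "C * N / 4 \<le> real J * real (card S)"
    using many cardR Q N unfolding S_def by linarith
  then have cardS: "C / (4 * J) * N \<le> real (card S)" using J by (simp add: field_simps)
  \<comment> \<open>\<open>g\<close> recovers the index of a term, so that pairs of progression
    terms become pairs of indices in \<open>{1..N}\<close>.\<close>
  define g where "g = the_inv_into {1..N} a"
  have g: "g (h + r * k) \<in> {1..N} \<and> a (g (h + r * k)) = h + r * k" if "r \<in> R" for r
  proof -
    have "h + r * k \<in> a ` {1..N}" using that A(1) by (auto simp: R_def)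
    then show ?thesis unfolding g_def
      using the_inv_into_into[OF inj] f_the_inv_into_f[OF inj] by blast
  qed
  have "inj_on (\<lambda>r. (g (h + (r + int j * q) * k), g (h + r * k))) S"
  proof (rule inj_onI)
    fix r r' assume *: "r \<in> S" "r' \<in> S"
      "(g (h + (r + int j * q) * k), g (h + r * k)) = (g (h + (r' + int j * q) * k), g (h + r' * k))"
    then have "h + r * k = h + r' * k" using g[of r] g[of r'] by (auto simp: S_def)
    with k show "r = r'" by simp
  qed
  moreover have "(\<lambda>r. (g (h + (r + int j * q) * k), g (h + r * k))) ` S \<subseteq> E"
  proof (rule image_subsetI)
    fix r assume "r \<in> S"
    then have r: "r \<in> R" "r + int j * q \<in> R" by (auto simp: S_def)
    note g1 = g[OF r(1)] and g2 = g[OF r(2)]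
    have "int j * q * k \<noteq> 0" using j q(1) k by auto
    then have "g (h + (r + int j * q) * k) \<noteq> g (h + r * k)"
      using g1 g2 by (auto simp: algebra_simps)
    moreover have "real_of_int (h + (r + int j * q) * k) * \<alpha> - real_of_int (h + r * k) * \<alpha>
        = real_of_int (int j * q * k) * \<alpha>" by (simp add: algebra_simps)
    ultimately show "(g (h + (r + int j * q) * k), g (h + r * k)) \<in> E"
      using g1 g2 unfolding E_def D_def
      by (simp only: mem_Collect_eq case_prod_conv dist_nearest_int_frac_diff simp_thms)
  qed
  moreover have "finite E"
    by (rule finite_subset[of _ "{1..N} \<times> {1..N}"]) (auto simp: E_def)
  ultimately have "card S \<le> card E" using card_inj_on_le by blast
  with cardS have cardE: "C / (4 * J) * N \<le> real (card E)" by linarith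
  \<comment> \<open>The integer \<open>j * p\<close> serves as the competitor: the Dirichlet error
    grows at most by the factor \<open>J\<close>.\<close>
  have "D \<le> \<bar>of_int (int j * q * k) * \<alpha> - of_int (int j * p)\<bar>"
    unfolding D_def by (rule dist_nearest_int_le)
  also have "\<dots> = real j * \<bar>of_int q * (of_int k * \<alpha>) - of_int p\<bar>"
  proof -
    have "of_int (int j * q * k) * \<alpha> - of_int (int j * p)
        = real j * (of_int q * (of_int k * \<alpha>) - of_int p)" by (simp add: algebra_simps)
    then show ?thesis by (simp add: abs_mult)
  qed
  also have "\<dots> \<le> real J * (1 / Q)" using j q(3) by (intro mult_mono) auto
  also have "\<dots> \<le> real J * (1 / (C * N / 4))"
    using Q C Npos by (intro mult_left_mono divide_left_mono) auto
  finally have "D * N \<le> 4 * real J / C" using C Npos by (simp add: field_simps)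
  moreover have "0 \<le> D * N" by (simp add: D_def dist_nearest_int_nonneg)
  ultimately show thesis using that[of "D * N"] cardE Npos by (simp add: E_def)
qed

section \<open>Contradiction along the sequence \<open>N i\<close>\<close>

theorem theorem1:
  fixes a :: "nat \<Rightarrow> int"
  assumes "strict_mono_on {1..} a"
    and "\<forall>n\<ge>1. a n > 0"
    and "quasi_arithmetic 1 a"
  shows "\<not> (\<exists>\<alpha>::real. poissonian_pair_correlations (\<lambda>n. frac (of_int (a n) * \<alpha>)))"
proof
  assume "\<exists>\<alpha>::real. poissonian_pair_correlations (\<lambda>n. frac (of_int (a n) * \<alpha>))"
  then obtain \<alpha> :: real where \<alpha>: "poissonian_pair_correlations (\<lambda>n. frac (of_int (a n) * \<alpha>))" ..
  obtain C K :: real and N :: "nat \<Rightarrow> nat" where C: "C > 0" "K > 0"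
    and N: "strict_mono_on {1..} N"
    and A: "\<And>i. i \<ge> 1 \<Longrightarrow> \<exists>A \<subseteq> a ` {1..N i}. real (card A) \<ge> C * real (N i) \<and>
           (\<exists>h k s. A \<subseteq> arith_progression 1 h k s \<and>
                    real_of_int (arith_progression_size 1 s) \<le> K * real (N i))"
    using assms(3) unfolding quasi_arithmetic_def by auto
  \<comment> \<open>This choice makes \<open>s / J\<close> at most a quarter of
    \<open>C * N i\<close>. It depends on \<open>C\<close> and \<open>K\<close> only, so the same
    bounds serve every \<open>i\<close>.\<close>
  define J where "J = nat \<lceil>4 * K / C\<rceil>"
  have "4 * K / C > 0" using C by simp
  then have J: "J > 0" "4 * K / C \<le> real J" unfolding J_def by linarith+
  then have J': "4 * K \<le> C * real J" using C by (simp add: field_simps)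
  \<comment> \<open>The shift by \<open>Suc\<close> is needed because \<open>N\<close> is known to
    be increasing only from index \<open>1\<close> on.\<close>
  have "strict_mono (\<lambda>i. N (Suc i))"
    using N by (auto simp: strict_mono_on_def intro!: strict_monoI)
  then have lim: "filterlim (\<lambda>i. N (Suc i)) sequentially sequentially"
    by (rule filterlim_subseq)
  have "\<forall>\<^sub>F n in sequentially. \<forall>\<tau>\<in>{0..4 * real J / C}.
    real (card {(i, j). i \<in> {1..n} \<and> j \<in> {1..n} \<and> i \<noteq> j \<and>
      dist_nearest_int (frac (of_int (a i) * \<alpha>) - frac (of_int (a j) * \<alpha>)) = \<tau> / real n})
      < C / (4 * real J) * real n"
    by (rule poissonian_pair_correlations_no_atoms[OF \<alpha>]) (use C J in simp)
  moreover have "\<forall>\<^sub>F n in sequentially. C * real n > 4"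
    using eventually_gt_at_top[of "nat \<lceil>4 / C\<rceil>"]
  proof eventually_elim
    case (elim n)
    then have "4 / C < real n" by linarith
    then show ?case using C by (simp add: field_simps)
  qed
  ultimately have "\<forall>\<^sub>F n in sequentially. C * real n > 4 \<and> (\<forall>\<tau>\<in>{0..4 * real J / C}.
    real (card {(i, j). i \<in> {1..n} \<and> j \<in> {1..n} \<and> i \<noteq> j \<and>
      dist_nearest_int (frac (of_int (a i) * \<alpha>) - frac (of_int (a j) * \<alpha>)) = \<tau> / real n})
      < C / (4 * real J) * real n)"
    by eventually_elim simp
  then have "\<forall>\<^sub>F i in sequentially. C * real (N (Suc i)) > 4 \<and> (\<forall>\<tau>\<in>{0..4 * real J / C}.
    real (card {(l, j). l \<in> {1..N (Suc i)} \<and> j \<in> {1..N (Suc i)} \<and> l \<noteq> j \<and>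
      dist_nearest_int (frac (of_int (a l) * \<alpha>) - frac (of_int (a j) * \<alpha>)) = \<tau> / real (N (Suc i))})
      < C / (4 * real J) * real (N (Suc i)))"
    by (rule eventually_compose_filterlim[OF _ lim])
  then obtain i where *: "C * real (N (Suc i)) > 4 \<and> (\<forall>\<tau>\<in>{0..4 * real J / C}.
    real (card {(l, j). l \<in> {1..N (Suc i)} \<and> j \<in> {1..N (Suc i)} \<and> l \<noteq> j \<and>
      dist_nearest_int (frac (of_int (a l) * \<alpha>) - frac (of_int (a j) * \<alpha>)) = \<tau> / real (N (Suc i))})
      < C / (4 * real J) * real (N (Suc i)))"
    using eventually_happens'[OF sequentially_bot] by blast
  define n where "n = N (Suc i)"
  have n: "C * real n > 4" and no_atom: "\<And>\<tau>. \<tau> \<in> {0..4 * real J / C} \<Longrightarrow>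
    real (card {(i, j). i \<in> {1..n} \<and> j \<in> {1..n} \<and> i \<noteq> j \<and>
      dist_nearest_int (frac (of_int (a i) * \<alpha>) - frac (of_int (a j) * \<alpha>)) = \<tau> / real n})
      < C / (4 * real J) * real n"
    using * unfolding n_def by blast+
  obtain B h k s where B: "B \<subseteq> a ` {1..n}" "real (card B) \<ge> C * real n"
    "B \<subseteq> arith_progression 1 h k s" "real_of_int (arith_progression_size 1 s) \<le> K * real n"
    using A[of "Suc i"] unfolding n_def by auto
  have "inj_on a {1..n}"
    using strict_mono_on_imp_inj_on[OF assms(1)] by (rule inj_on_subset) auto
  moreover have "B \<subseteq> (\<lambda>r. h + r * k 1) ` {0..<s 1}"
  proof
    fix x assume "x \<in> B"
    then have "x \<in> arith_progression 1 h k s" using B(3) by blast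
    then obtain r where "x = h + (\<Sum>j=1..1. r j * k j)" "\<forall>j\<in>{1..1}. 0 \<le> r j \<and> r j < s j"
      unfolding arith_progression_def by blast
    then show "x \<in> (\<lambda>r. h + r * k 1) ` {0..<s 1}" by (intro image_eqI[of _ _ "r 1"]) auto
  qed
  moreover have "real_of_int (s 1) \<le> K * real n"
    using B(4) by (simp add: arith_progression_size_def)
  ultimately obtain \<tau> where \<tau>: "\<tau> \<in> {0..4 * real J / C}"
    and "C / (4 * real J) * real n \<le> real (card {(i, j). i \<in> {1..n} \<and> j \<in> {1..n} \<and> i \<noteq> j \<and>
      dist_nearest_int (frac (of_int (a i) * \<alpha>) - frac (of_int (a j) * \<alpha>)) = \<tau> / real n})"
    by (rule arith_progression_atom[OF _ B(1) _ C(1) B(2) _ J(1) J' n])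
  with no_atom[OF \<tau>] show False by linarith
qed

end
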